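(* Consider an instance of the multi-line drive-by sensing bus assignment and scheduling problem. Let $z^*$ be the optimal objective value of the linearized model (P), let $z$ be the objective value of the solution produced by the batch scheduling algorithm, and let $C_{\mathrm{NB}}^*, C_{\mathrm{BS}}^*, R_{\mathrm{BS}}^*, C_{\mathrm{DS}}^*, R_{\mathrm{DS}}^*$ be the quantities defined by the sub-problems SP1, SP2, SP3 (all defined in the context). Then the following hold. (1) Lower and upper bounds: $$C_{\mathrm{NB}}^*-\delta R_{\mathrm{DS}}^*\ \le\ z^*\ \le\ z\ \le\ \max\{C_{\mathrm{DS}}^*-\delta R_{\mathrm{DS}}^*,\ C_{\mathrm{BS}}^*-\delta R_{\mathrm{BS}}^*\}.$$ (2) Gap estimate: $$\frac{z-z^*}{z^*}\ \le\ \frac{\max\{C_{\mathrm{DS}}^*-\delta R_{\mathrm{DS}}^*,\ C_{\mathrm{BS}}^*-\delta R_{\mathrm{BS}}^*\}}{C_{\mathrm{NB}}^*-\delta R_{\mathrm{DS}}^*}-1.$$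
   Context: **Instance data.** $B$ is a finite set of buses, partitioned as $B=B_{\mathrm{IB}}\sqcup B_{\mathrm{NB}}$ (instrumented buses, IBs, and normal buses, NBs), with $|B_{\mathrm{IB}}|=M$, where $M$ is the maximum number of IBs. $\Theta$ is a finite set of depots. The time-expanded network has a finite set $N$ of timed nodes $(i,t)$ (terminal $i$ at discrete time $t$), together with depot start nodes $(i,s)$ and depot end nodes $(i,e)$, $i\in\Theta$, where $s,e$ are the start and end of the planning horizon; depot start and end nodes act as source and sink and are not in $N$. The finite set of directed arcs $((i,t),(j,\bar t))$ is $A=A_d\cup A_r\cup A_w\cup A_p$: service arcs $A_d$ (timetabled trips), relocation arcs $A_r$, wait arcs $A_w$, and pull-out/pull-in arcs $A_p$ (pull-out arcs $((i,s),(j,\bar t))$, pull-in arcs $((j,\bar t),(i,e))$). Each arc has a cost $c_{ij}^{t\bar t}$ (wait arcs have cost $0$). $G$ is a finite set of spatial grids and $T^s$ a finite set of sensing periods; $\mu_{gk}\ge 0$ are weights with $\sum_{g\in G,k\in T^s}\mu_{gk}=1$; $\beta_{ijg}^{t\bar tk}\in\{0,1\}$ indicates whether $(g,k)$ is covered by arc $((i,t),(j,\bar t))$. $\delta>0$ is a weighting factor. $\hat f(q)=\min_{1\le l\le L}(m_lq+c_l)$, $q\ge0$, is a given concave, nondecreasing, piecewise affine function with $\hat f(0)=0$ (an approximation of $q\mapsto q^{0.5}$). **Routing constraints for a set $B'\subseteq B$**, in binary variables $v_{bi}$ ($b\in B'$, $i\in\Theta$) and $y_{ijb}^{t\bar t}$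 ($b\in B'$, $((i,t),(j,\bar t))\in A$): - $\sum_{i\in\Theta}v_{bi}\le1$ for all $b\in B'$; - $\sum_{((i,s),(j,\bar t))\in A_p}y_{ijb}^{s\bar t}\le v_{bi}$ for all $b\in B'$, $i\in\Theta$; - $\sum_{((i,s),(j,\bar t))\in A_p}y_{ijb}^{s\bar t}-\sum_{((j,\bar t),(i,e))\in A_p}y_{jib}^{\bar te}=0$ for all $b\in B'$, $i\in\Theta$; - $\sum_{((j,\bar t),(i,t))\in A}y_{jib}^{\bar tt}-\sum_{((i,t),(j,\bar t))\in A}y_{ijb}^{t\bar t}=0$ for all $b\in B'$, $(i,t)\in N$; - $y_{jib}^{\bar tt}+y_{ijb}^{t\bar t}\le1$ for all $b\in B'$, $((i,t),(j,\bar t))\in A_r$ (a variable is taken as $0$ if its arc is absent). **Model (P).** Variables: $x_b\in\{0,1\}$ ($b\in B$), $v,y$ satisfying the routing constraints for $B$, and real $\zeta_{ijb}^{t\bar t}$, $q_{gk}$, $r_{gk}$. Minimize $$\sum_{b\in B}\sum_{((i,t),(j,\bar t))\in A}c_{ij}^{t\bar t}y_{ijb}^{t\bar t}-\delta\sum_{g\in G}\sum_{k\in T^s}\mu_{gk}r_{gk}$$ subject also to: $\sum_{b\in B}y_{ijb}^{t\bar t}\ge1$ for all arcs in $A_d$; $\sum_{b\in B}x_b\le M$; $\zeta_{ijb}^{t\bar t}\le x_b$, $\zeta_{ijb}^{t\bar t}\le y_{ijb}^{t\bar t}$, $\zeta_{ijb}^{t\bar t}\ge x_b+y_{ijb}^{t\bar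 t}-1$, $\zeta_{ijb}^{t\bar t}\ge0$ for all $b\in B$ and all arcs; $q_{gk}=\sum_{b\in B}\sum_{((i,t),(j,\bar t))\in A}\zeta_{ijb}^{t\bar t}\beta_{ijg}^{t\bar tk}$; and $r_{gk}\le m_lq_{gk}+c_l$ for all $g,k$ and $l=1,\dots,L$. **IB sub-model with parameter $\omega\ge0$.** Variables $v,y$ satisfying the routing constraints for $B_{\mathrm{IB}}$, $h_{ij}^{t\bar t}\in\{0,1\}$ for arcs in $A_d$, and real $q_{gk},r_{gk}$. Maximize $$\sum_{A_d}c_{ij}^{t\bar t}h_{ij}^{t\bar t}+\omega\,\delta\sum_{g,k}\mu_{gk}r_{gk}-\sum_{b\in B_{\mathrm{IB}}}\sum_{A_r}c_{ij}^{t\bar t}y_{ijb}^{t\bar t}$$ subject also to $\sum_{b\in B_{\mathrm{IB}}}y_{ijb}^{t\bar t}\ge h_{ij}^{t\bar t}$ on $A_d$, $q_{gk}=\sum_{b\in B_{\mathrm{IB}}}\sum_Ay_{ijb}^{t\bar t}\beta_{ijg}^{t\bar tk}$, and $r_{gk}\le m_lq_{gk}+c_l$ for all $g,k,l$. **NB sub-model.** Given a set $A_d^{\mathrm{IB}}\subseteq A_d$ of trips covered by IBs, put $A_d^{\mathrm{NB}}=A_d\setminus A_d^{\mathrm{IB}}$. Minimize $\sum_{b\in B_{\mathrm{NB}}}\sum_Ac_{ij}^{t\bar t}y_{ijb}^{t\bar t}$ over $v,y$ satisfying the routing constraints for $B_{\mathrm{NB}}$ and $\sum_{b\in B_{\mathrm{NB}}}y_{ijb}^{t\bar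 t}\ge1$ on $A_d^{\mathrm{NB}}$. **Batch scheduling algorithm.** For each $\omega=0,\Delta,2\Delta,\dots,\bar\omega$ (with increment $\Delta>0$ and maximum $\bar\omega>0$): solve the IB sub-model to optimality, set $A_d^{\mathrm{IB}}=\{((i,t),(j,\bar t))\in A_d: h_{ij}^{t\bar t}=1\}$, then solve the NB sub-model to optimality, and evaluate the combined schedule with the objective of (P), namely (total cost $\sum_{b\in B}\sum_Ac_{ij}^{t\bar t}y_{ijb}^{t\bar t}$) $-\,\delta\sum_{g,k}\mu_{gk}\hat f(q_{gk})$ with $q_{gk}$ computed from the IB schedules (the value is $+\infty$ if the NB sub-model is infeasible). The output is the schedule with the smallest value over the tested $\omega$, and $z$ is this value. **Sub-problems.** - SP1: minimize $\sum_{b\in B}\sum_Ac_{ij}^{t\bar t}y_{ijb}^{t\bar t}$ over $v,y$ satisfying the routing constraints for $B$ and $\sum_{b\in B}y_{ijb}^{t\bar t}\ge1$ on $A_d$. Its optimal value is $C_{\mathrm{NB}}^*$. - SP2 (the case $\omega=0$ of the batch scheduling algorithm): first maximize $\sum_{A_d}c_{ij}^{t\bar t}h_{ij}^{t\bar t}-\sum_{b\in B_{\mathrm{IB}}}\sum_{A_r}c_{ij}^{t\bar t}y_{ijb}^{t\bar t}$ over $v,y,h$ satisfying the routing constraints for $B_{\mathrm{IB}}$ and $\sum_{b\in B_{\mathrm{IB}}}y_{ijb}^{t\bar t}\ge h_{ij}^{t\bar t}$ on $A_d$; then solve the NB sub-model for the resulting uncovered trips. $C_{\mathrm{BS}}^*$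 is the total operational cost of all buses in the resulting schedule and $R_{\mathrm{BS}}^*=\sum_{g,k}\mu_{gk}\hat f(q_{gk})$ is the sensing value of its IB schedules. - SP3 (the case $\omega\to+\infty$): first maximize $\sum_{g,k}\mu_{gk}r_{gk}$ over $v,y,q,r$ satisfying the routing constraints for $B_{\mathrm{IB}}$, $q_{gk}=\sum_{b\in B_{\mathrm{IB}}}\sum_Ay_{ijb}^{t\bar t}\beta_{ijg}^{t\bar tk}$, and $r_{gk}\le m_lq_{gk}+c_l$ for all $g,k,l$; then solve the NB sub-model for the service arcs not traversed by any IB. $R_{\mathrm{DS}}^*$ is the optimal value of the first stage and $C_{\mathrm{DS}}^*$ is the total operational cost of all buses in the resulting schedule.
   Formalization: The gap estimate (2) is stated only when (P) is feasible and the lower bound C_NB* − δR_DS* is positive; for a negative lower bound it can fail, and for a zero one or infeasible (P) it is undefined. C_BS* and R_BS* are those of the algorithm's own ω=0 run. *)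

theory Defs
  imports "HOL-Analysis.Analysis"
begin

text \<open>
  A node is a pair (location, time); depots are locations. Functions (costs, weights, decision
  variables) are total, but only their values on the index sets of the instance matter.
\<close>

type_synonym 'l node = "'l \<times> nat"
type_synonym 'l arc = "'l node \<times> 'l node"

record ('b, 'l, 'g, 'k) dbs_instance =
  IB :: "'b set"
  NB :: "'b set"
  max_IB :: nat  \<comment> \<open>\<open>M\<close>\<close>
  depots :: "'l set"
  start_time :: nat
  end_time :: nat
  nodes :: "'l node set"  \<comment> \<open>\<open>N\<close>, without depot start and end nodes\<close>
  A_d :: "'l arc set"
  A_r :: "'l arc set"
  A_w :: "'l arc set"
  A_p :: "'l arc set"
  cost :: "'l arc \<Rightarrow> real"
  grids :: "'g set"
  periods :: "'k set"
  \<mu> :: "'g \<Rightarrow> 'k \<Rightarrow> real"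
  \<beta> :: "'l arc \<Rightarrow> 'g \<Rightarrow> 'k \<Rightarrow> real"
  \<delta> :: real
  pieces :: nat  \<comment> \<open>\<open>L\<close>\<close>
  slope :: "nat \<Rightarrow> real"
  icept :: "nat \<Rightarrow> real"

definition buses :: "('b, 'l, 'g, 'k) dbs_instance \<Rightarrow> 'b set" where
  "buses I = IB I \<union> NB I"

definition arcs :: "('b, 'l, 'g, 'k) dbs_instance \<Rightarrow> 'l arc set" where
  "arcs I = A_d I \<union> A_r I \<union> A_w I \<union> A_p I"

definition fhat :: "('b, 'l, 'g, 'k) dbs_instance \<Rightarrow> real \<Rightarrow> real" where
  "fhat I q = Min ((\<lambda>l. slope I l * q + icept I l) ` {1..pieces I})"

text \<open>Costs may be arbitrary reals (zero on wait arcs), and the arc classes need not be disjoint.\<close>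

definition valid_instance :: "('b, 'l, 'g, 'k) dbs_instance \<Rightarrow> bool" where
  "valid_instance I \<longleftrightarrow>
     finite (IB I) \<and> finite (NB I) \<and> IB I \<inter> NB I = {} \<and> card (IB I) = max_IB I \<and>
     finite (depots I) \<and> start_time I < end_time I \<and> finite (nodes I) \<and>
     (\<forall>i\<in>depots I. (i, start_time I) \<notin> nodes I \<and> (i, end_time I) \<notin> nodes I) \<and>
     finite (arcs I) \<and> A_d I \<union> A_r I \<union> A_w I \<subseteq> nodes I \<times> nodes I \<and>
     A_p I \<subseteq> {((i, start_time I), n) | i n. i \<in> depots I \<and> n \<in> nodes I} \<union>
             {(n, (i, end_time I)) | i n. i \<in> depots I \<and> n \<in> nodes I} \<and>
     (\<forall>a\<in>A_w I. cost I a = 0) \<and>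
     finite (grids I) \<and> finite (periods I) \<and>
     (\<forall>g\<in>grids I. \<forall>k\<in>periods I. \<mu> I g k \<ge> 0) \<and>
     (\<Sum>g\<in>grids I. \<Sum>k\<in>periods I. \<mu> I g k) = 1 \<and>
     (\<forall>a\<in>arcs I. \<forall>g\<in>grids I. \<forall>k\<in>periods I. \<beta> I a g k \<in> {0, 1}) \<and>
     \<delta> I > 0 \<and>
     pieces I \<ge> 1 \<and> concave_on {0..} (fhat I) \<and> mono_on {0..} (fhat I) \<and> fhat I 0 = 0"

text \<open>In the last constraint, \<open>prod.swap a\<close> is the reverse of the arc \<open>a\<close>.\<close>

definition routing ::
  "('b, 'l, 'g, 'k) dbs_instance \<Rightarrow> 'b set \<Rightarrow> ('b \<Rightarrow> 'l \<Rightarrow> real) \<Rightarrow> ('b \<Rightarrow> 'l arc \<Rightarrow> real) \<Rightarrow> bool"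
where
  "routing I B' v y \<longleftrightarrow>
     (\<forall>b\<in>B'. \<forall>i\<in>depots I. v b i \<in> {0, 1}) \<and>
     (\<forall>b\<in>B'. \<forall>a\<in>arcs I. y b a \<in> {0, 1}) \<and>
     (\<forall>b\<in>B'. (\<Sum>i\<in>depots I. v b i) \<le> 1) \<and>
     (\<forall>b\<in>B'. \<forall>i\<in>depots I. (\<Sum>a | a \<in> A_p I \<and> fst a = (i, start_time I). y b a) \<le> v b i) \<and>
     (\<forall>b\<in>B'. \<forall>i\<in>depots I.
        (\<Sum>a | a \<in> A_p I \<and> fst a = (i, start_time I). y b a)
        - (\<Sum>a | a \<in> A_p I \<and> snd a = (i, end_time I). y b a) = 0) \<and>
     (\<forall>b\<in>B'. \<forall>n\<in>nodes I.
        (\<Sum>a | a \<in> arcs I \<and> snd a = n. y b a) - (\<Sum>a | a \<in> arcs I \<and> fst a = n. y b a) = 0) \<and>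
     (\<forall>b\<in>B'. \<forall>a\<in>A_r I. (if prod.swap a \<in> arcs I then y b (prod.swap a) else 0) + y b a \<le> 1)"

definition op_cost ::
  "('b, 'l, 'g, 'k) dbs_instance \<Rightarrow> 'b set \<Rightarrow> ('b \<Rightarrow> 'l arc \<Rightarrow> real) \<Rightarrow> real" where
  "op_cost I B' y = (\<Sum>b\<in>B'. \<Sum>a\<in>arcs I. cost I a * y b a)"

definition weighted_sum :: "('b, 'l, 'g, 'k) dbs_instance \<Rightarrow> ('g \<Rightarrow> 'k \<Rightarrow> real) \<Rightarrow> real" where
  "weighted_sum I r = (\<Sum>g\<in>grids I. \<Sum>k\<in>periods I. \<mu> I g k * r g k)"

definition coverage ::
  "('b, 'l, 'g, 'k) dbs_instance \<Rightarrow> 'b set \<Rightarrow> ('b \<Rightarrow> 'l arc \<Rightarrow> real) \<Rightarrow> 'g \<Rightarrow> 'k \<Rightarrow> real" where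
  "coverage I B' w g k = (\<Sum>b\<in>B'. \<Sum>a\<in>arcs I. w b a * \<beta> I a g k)"

text \<open>The constraints on \<open>q\<close> and \<open>r\<close>, where \<open>w\<close> is \<open>\<zeta>\<close> in (P) and \<open>y\<close> in the sub-models.\<close>

definition sensing ::
  "('b, 'l, 'g, 'k) dbs_instance \<Rightarrow> 'b set \<Rightarrow> ('b \<Rightarrow> 'l arc \<Rightarrow> real) \<Rightarrow>
     ('g \<Rightarrow> 'k \<Rightarrow> real) \<Rightarrow> ('g \<Rightarrow> 'k \<Rightarrow> real) \<Rightarrow> bool" where
  "sensing I B' w q r \<longleftrightarrow>
     (\<forall>g\<in>grids I. \<forall>k\<in>periods I.
        q g k = coverage I B' w g k \<and>
        (\<forall>l\<in>{1..pieces I}. r g k \<le> slope I l * q g k + icept I l))"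

definition P_feasible where
  "P_feasible I =
     {(x, v, y, \<zeta>, q, r).
        (\<forall>b\<in>buses I. x b \<in> {0, 1 :: real}) \<and>
        routing I (buses I) v y \<and>
        (\<forall>a\<in>A_d I. (\<Sum>b\<in>buses I. y b a) \<ge> 1) \<and>
        (\<Sum>b\<in>buses I. x b) \<le> real (max_IB I) \<and>
        (\<forall>b\<in>buses I. \<forall>a\<in>arcs I.
           \<zeta> b a \<le> x b \<and> \<zeta> b a \<le> y b a \<and> \<zeta> b a \<ge> x b + y b a - 1 \<and> \<zeta> b a \<ge> 0) \<and>
        sensing I (buses I) \<zeta> q r}"

definition P_objective where
  "P_objective I = (\<lambda>(x, v, y, \<zeta>, q, r). op_cost I (buses I) y - \<delta> I * weighted_sum I r)"

text \<open>
  Optimal values are extended reals, so that an infeasible minimization problem has value \<open>\<infinity>\<close>.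
\<close>

definition z_star :: "('b, 'l, 'g, 'k) dbs_instance \<Rightarrow> ereal" where
  "z_star I = (INF s\<in>P_feasible I. ereal (P_objective I s))"

definition IB_feasible where
  "IB_feasible I =
     {(v, y, h, q, r).
        routing I (IB I) v y \<and>
        (\<forall>a\<in>A_d I. h a \<in> {0, 1 :: real}) \<and>
        (\<forall>a\<in>A_d I. (\<Sum>b\<in>IB I. y b a) \<ge> h a) \<and>
        sensing I (IB I) y q r}"

definition IB_objective where
  "IB_objective I \<omega> =
     (\<lambda>(v, y, h, q, r).
        (\<Sum>a\<in>A_d I. cost I a * h a) + \<omega> * \<delta> I * weighted_sum I r
        - (\<Sum>b\<in>IB I. \<Sum>a\<in>A_r I. cost I a * y b a))"

text \<open>
  Minimum-cost coverage of the trips \<open>D\<close> by the buses \<open>B'\<close>: the NB sub-model for \<open>B' = NB I\<close>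
  and \<open>D\<close> the trips left uncovered, SP1 for \<open>B' = buses I\<close> and \<open>D = A_d I\<close>.
\<close>

definition cover_feasible where
  "cover_feasible I B' D = {(v, y). routing I B' v y \<and> (\<forall>a\<in>D. (\<Sum>b\<in>B'. y b a) \<ge> 1)}"

definition cover_objective where
  "cover_objective I B' = (\<lambda>(v, y). op_cost I B' y)"

text \<open>
  \<open>NB_result I D res\<close>: \<open>res\<close> is a result of solving the NB sub-model for the uncovered trips \<open>D\<close>
  to optimality, with \<open>None\<close> signalling infeasibility.
\<close>

definition NB_result where
  "NB_result I D res \<longleftrightarrow>
     (case res of
        None \<Rightarrow> cover_feasible I (NB I) D = {}
      | Some s \<Rightarrow> is_arg_min (cover_objective I (NB I)) (\<lambda>s. s \<in> cover_feasible I (NB I) D) s)"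

text \<open>
  Total cost of the schedule combining IB routes \<open>y\<close> with the result of the NB sub-model, and
  sensing value of the IB routes \<open>y\<close>.
\<close>

definition total_cost where
  "total_cost I y res =
     (case res of
        None \<Rightarrow> (\<infinity> :: ereal)
      | Some (v', y') \<Rightarrow> ereal (op_cost I (buses I) (\<lambda>b. if b \<in> IB I then y b else y' b)))"

definition sensing_value where
  "sensing_value I y = weighted_sum I (\<lambda>g k. fhat I (coverage I (IB I) y g k))"

text \<open>
  \<open>run \<omega>\<close> records the solutions found for the parameter \<open>\<omega>\<close>; they are arbitrary optimal ones.
\<close>

definition tested :: "real \<Rightarrow> real \<Rightarrow> real set" where
  "tested \<Delta> \<omega>max = {real n * \<Delta> | n. real n * \<Delta> \<le> \<omega>max}"

definition batch_run where
  "batch_run I \<Delta> \<omega>max run \<longleftrightarrow>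
     (\<forall>\<omega>\<in>tested \<Delta> \<omega>max. case run \<omega> of ((v, y, h, q, r), res) \<Rightarrow>
        is_arg_max (IB_objective I \<omega>) (\<lambda>s. s \<in> IB_feasible I) (v, y, h, q, r) \<and>
        NB_result I (A_d I - {a \<in> A_d I. h a = 1}) res)"

definition evaluation where
  "evaluation I =
     (\<lambda>((v, y, h, q, r), res). total_cost I y res - ereal (\<delta> I * sensing_value I y))"

definition C_NB :: "('b, 'l, 'g, 'k) dbs_instance \<Rightarrow> ereal" where
  "C_NB I = (INF s\<in>cover_feasible I (buses I) (A_d I). ereal (cover_objective I (buses I) s))"

definition SP2_feasible where
  "SP2_feasible I =
     {(v, y, h).
        routing I (IB I) v y \<and>
        (\<forall>a\<in>A_d I. h a \<in> {0, 1 :: real}) \<and>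
        (\<forall>a\<in>A_d I. (\<Sum>b\<in>IB I. y b a) \<ge> h a)}"

definition SP2_objective where
  "SP2_objective I =
     (\<lambda>(v, y, h). (\<Sum>a\<in>A_d I. cost I a * h a) - (\<Sum>b\<in>IB I. \<Sum>a\<in>A_r I. cost I a * y b a))"

definition SP2_solution where
  "SP2_solution I v y h res \<longleftrightarrow>
     is_arg_max (SP2_objective I) (\<lambda>s. s \<in> SP2_feasible I) (v, y, h) \<and>
     NB_result I (A_d I - {a \<in> A_d I. h a = 1}) res"

definition SP3_feasible where
  "SP3_feasible I = {(v, y, q, r). routing I (IB I) v y \<and> sensing I (IB I) y q r}"

definition SP3_objective where
  "SP3_objective I = (\<lambda>(v, y, q, r). weighted_sum I r)"

definition R_DS :: "('b, 'l, 'g, 'k) dbs_instance \<Rightarrow> ereal" where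
  "R_DS I = (SUP s\<in>SP3_feasible I. ereal (SP3_objective I s))"

definition SP3_solution where
  "SP3_solution I v y q r res \<longleftrightarrow>
     is_arg_max (SP3_objective I) (\<lambda>s. s \<in> SP3_feasible I) (v, y, q, r) \<and>
     NB_result I (A_d I - {a \<in> A_d I. \<exists>b\<in>IB I. y b a = 1}) res"

end

theory Submission
  imports Defs
begin

text \<open>
  The lower bound relaxes (P) in two independent ways. Forgetting the sensing variables leaves a
  feasible point of SP1, so the cost part of any feasible point of (P) is at least \<open>C_NB\<close>. Forgetting
  the trips leaves at most \<open>M\<close> instrumented buses with their routes. Buses are interchangeable in all
  constraints, and \<open>M\<close> is exactly the number of buses in \<open>B_IB\<close>, so these routes can be handed over to
  buses of \<open>B_IB\<close>, the others staying idle. This is a feasible point of SP3 with the same \<open>r\<close>, so the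
  sensing part is at most \<open>R_DS\<close> (lemma \<open>P_sensing_le_R_DS\<close>).

  For \<open>z* \<le> z\<close>, the schedule assembled by the algorithm is a feasible point of (P) if exactly the
  buses in \<open>B_IB\<close> are instrumented; the choice \<open>\<zeta> = x y\<close>, \<open>r = fhat q\<close> makes its objective equal to the
  evaluation of the algorithm (lemma \<open>z_star_le_evaluation\<close>). The upper bound on \<open>z\<close> holds
  because \<open>\<omega> = 0\<close> is among the tested values and its schedule has the value \<open>C_BS - \<delta> R_BS\<close>.

  The gap estimate follows from the bounds alone: if \<open>0 < l \<le> z* \<le> z \<le> u\<close> and \<open>z*\<close> is finite, which
  feasibility of (P) guarantees, then \<open>z / z* \<le> u / l\<close>. Here \<open>z\<close> and \<open>u\<close> may be infinite.
\<close>

lemma routing_iff_each_bus: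
  "routing I B v y \<longleftrightarrow> (\<forall>b\<in>B. routing I UNIV (\<lambda>_. v b) (\<lambda>_. y b))"
  unfolding routing_def by auto

lemma routing_idle: "routing I B (\<lambda>_ _. 0) (\<lambda>_ _. 0)"
  unfolding routing_def by simp

lemma fhat_le_piece:
  "l \<in> {1..pieces I} \<Longrightarrow> fhat I q \<le> slope I l * q + icept I l"
  unfolding fhat_def by (intro Min_le) auto

text \<open>
  The linearization is exact for binary \<open>x\<close>: \<open>\<zeta>\<close> vanishes on the buses with \<open>x = 0\<close> and agrees with
  \<open>y\<close> on the others.
\<close>

lemma coverage_linearized:
  assumes "finite B" and "\<forall>b\<in>B. x b \<in> {0, 1 :: real}"
    and "\<forall>b\<in>B. \<forall>a\<in>arcs I. \<zeta> b a \<le> x b \<and> \<zeta> b a \<le> y b a \<and> \<zeta> b a \<ge> x b + y b a - 1 \<and> \<zeta> b a \<ge> 0"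
  shows "coverage I B \<zeta> = coverage I {b \<in> B. x b = 1} y"
proof (intro ext)
  fix g k
  have off: "\<zeta> b a = 0" if "b \<in> B" "x b \<noteq> 1" "a \<in> arcs I" for b a
    using assms(2,3) that by (metis antisym insertE singletonD)
  have on: "\<zeta> b a = y b a" if "b \<in> B" "x b = 1" "a \<in> arcs I" for b a
    using assms(3) that by force
  show "coverage I B \<zeta> g k = coverage I {b \<in> B. x b = 1} y g k"
    unfolding coverage_def
    by (rule sum.mono_neutral_cong_right) (use assms(1) off on in auto)
qed

text \<open>
  Buses are interchangeable: routes of a set \<open>S\<close> of buses can be driven by any set \<open>B'\<close> that has
  at least as many.
\<close>

lemma transfer_routes:
  assumes "finite S" "finite B'" "card S \<le> card B'" and "routing I S v y"
  obtains v' y' where "routing I B' v' y'" "coverage I B' y' = coverage I S y"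
proof -
  obtain f where f: "f ` S \<subseteq> B'" "inj_on f S"
    using card_le_inj assms(1-3) by blast
  define v' where "v' b = (if b \<in> f ` S then v (the_inv_into S f b) else (\<lambda>_. 0))" for b
  define y' where "y' b = (if b \<in> f ` S then y (the_inv_into S f b) else (\<lambda>_. 0))" for b
  have "routing I UNIV (\<lambda>_. v' b) (\<lambda>_. y' b)" for b
  proof (cases "b \<in> f ` S")
    case True
    then have "the_inv_into S f b \<in> S"
      using f(2) by (simp add: the_inv_into_into)
    then show ?thesis
      using assms(4) True unfolding v'_def y'_def by (subst (asm) routing_iff_each_bus) simp
  next
    case False
    then show ?thesis
      using routing_idle unfolding v'_def y'_def by simp
  qed
  then have "routing I B' v' y'"
    by (subst routing_iff_each_bus) simp
  moreover have "coverage I B' y' g k = coverage I S y g k" for g k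
  proof -
    have "coverage I B' y' g k = coverage I (f ` S) y' g k"
      unfolding coverage_def
      by (rule sum.mono_neutral_right) (use assms(2) f(1) in \<open>auto simp: y'_def\<close>)
    also have "\<dots> = coverage I S y g k"
      using f(2) by (simp add: coverage_def sum.reindex y'_def the_inv_into_f_f)
    finally show ?thesis .
  qed
  ultimately show thesis
    using that by blast
qed

lemma P_sensing_le_R_DS:
  assumes "valid_instance I" and "(x, v, y, \<zeta>, q, r) \<in> P_feasible I"
  shows "ereal (weighted_sum I r) \<le> R_DS I"
proof -
  define S where "S = {b \<in> buses I. x b = 1}"
  have fin: "finite (buses I)" "finite (IB I)" and cardIB: "card (IB I) = max_IB I"
    using assms(1) unfolding valid_instance_def buses_def by auto
  have x: "\<forall>b\<in>buses I. x b \<in> {0, 1}" and R: "routing I (buses I) v y"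
    and sum_x: "(\<Sum>b\<in>buses I. x b) \<le> real (max_IB I)"
    and \<zeta>: "\<forall>b\<in>buses I. \<forall>a\<in>arcs I.
           \<zeta> b a \<le> x b \<and> \<zeta> b a \<le> y b a \<and> \<zeta> b a \<ge> x b + y b a - 1 \<and> \<zeta> b a \<ge> 0"
    and sens: "sensing I (buses I) \<zeta> q r"
    using assms(2) unfolding P_feasible_def by auto
  have "(\<Sum>b\<in>buses I. x b) = (\<Sum>b\<in>S. 1)"
    by (rule sum.mono_neutral_cong_right) (use fin x S_def in auto)
  then have "card S \<le> card (IB I)"
    using sum_x cardIB by simp
  moreover have "finite S" "routing I S v y"
    using fin R routing_iff_each_bus[of I S v y] routing_iff_each_bus[of I "buses I" v y]
    unfolding S_def by auto
  ultimately obtain v' y' where R': "routing I (IB I) v' y'"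
      and "coverage I (IB I) y' = coverage I S y"
    using transfer_routes fin(2) by metis
  then have cov: "coverage I (IB I) y' = coverage I (buses I) \<zeta>"
    using coverage_linearized[OF fin(1) x \<zeta>] S_def by simp
  have "sensing I (IB I) y' q r"
    using sens unfolding sensing_def cov .
  then have "(v', y', q, r) \<in> SP3_feasible I"
    using R' unfolding SP3_feasible_def by simp
  then show ?thesis
    unfolding R_DS_def by (rule SUP_upper2) (simp add: SP3_objective_def)
qed

lemma C_NB_le_op_cost:
  assumes "(x, v, y, \<zeta>, q, r) \<in> P_feasible I"
  shows "C_NB I \<le> ereal (op_cost I (buses I) y)"
proof -
  have "(v, y) \<in> cover_feasible I (buses I) (A_d I)"
    using assms unfolding P_feasible_def cover_feasible_def by auto
  then show ?thesis
    unfolding C_NB_def by (rule INF_lower2) (simp add: cover_objective_def)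
qed

lemma lower_bound_le_z_star:
  assumes "valid_instance I"
  shows "C_NB I - ereal (\<delta> I) * R_DS I \<le> z_star I"
  unfolding z_star_def
proof (rule INF_greatest)
  fix s assume s_in: "s \<in> P_feasible I"
  obtain x v y \<zeta> q r where s: "s = (x, v, y, \<zeta>, q, r)"
    by (metis prod_cases6)
  have "\<delta> I \<ge> 0"
    using assms unfolding valid_instance_def by simp
  then have "ereal (\<delta> I) * ereal (weighted_sum I r) \<le> ereal (\<delta> I) * R_DS I"
    using P_sensing_le_R_DS assms s_in s by (intro ereal_mult_left_mono) auto
  then have "C_NB I - ereal (\<delta> I) * R_DS I
      \<le> ereal (op_cost I (buses I) y) - ereal (\<delta> I) * ereal (weighted_sum I r)"
    using C_NB_le_op_cost s_in s by (intro ereal_minus_mono) auto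
  also have "\<dots> = ereal (P_objective I s)"
    by (simp add: s P_objective_def)
  finally show "C_NB I - ereal (\<delta> I) * R_DS I \<le> ereal (P_objective I s)" .
qed

text \<open>
  A trip is covered in the combined schedule either by an instrumented bus, when \<open>h = 1\<close>, or by the
  NB sub-model. An infeasible NB sub-model makes the evaluation infinite.
\<close>

lemma z_star_le_evaluation:
  assumes valid: "valid_instance I"
    and IBf: "(v, y, h, q, r) \<in> IB_feasible I"
    and NBr: "NB_result I (A_d I - {a \<in> A_d I. h a = 1}) res"
  shows "z_star I \<le> evaluation I ((v, y, h, q, r), res)"
proof (cases res)
  case None
  then show ?thesis
    by (simp add: evaluation_def total_cost_def)
next
  case (Some s)
  obtain v' y' where res: "res = Some (v', y')"
    using Some by (cases s) auto
  define v'' where "v'' b = (if b \<in> IB I then v b else v' b)" for b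
  define y'' where "y'' b = (if b \<in> IB I then y b else y' b)" for b
  define x :: "'a \<Rightarrow> real" where "x b = (if b \<in> IB I then 1 else 0)" for b
  define \<zeta> where "\<zeta> b a = x b * y'' b a" for b a
  define q' where "q' = coverage I (IB I) y"
  define r' where "r' g k = fhat I (q' g k)" for g k
  have fin: "finite (IB I)" "finite (NB I)" and disj: "IB I \<inter> NB I = {}"
    and cardIB: "card (IB I) = max_IB I"
    using valid unfolding valid_instance_def by auto
  have finb: "finite (buses I)" and IBb: "IB I \<subseteq> buses I"
    using fin by (auto simp: buses_def)
  have IBR: "routing I (IB I) v y" and cov_IB: "\<forall>a\<in>A_d I. (\<Sum>b\<in>IB I. y b a) \<ge> h a"
    using IBf unfolding IB_feasible_def by auto
  have NBR: "routing I (NB I) v' y'"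
    and cov_NB: "\<forall>a\<in>A_d I - {a \<in> A_d I. h a = 1}. (\<Sum>b\<in>NB I. y' b a) \<ge> 1"
    using NBr res unfolding NB_result_def is_arg_min_def cover_feasible_def by auto
  have R: "routing I (buses I) v'' y''"
    using IBR NBR
      routing_iff_each_bus[of I "IB I" v y] routing_iff_each_bus[of I "NB I" v' y']
      routing_iff_each_bus[of I "buses I" v'' y'']
    unfolding buses_def v''_def y''_def by auto
  have y''01: "y'' b a \<in> {0, 1}" if "b \<in> buses I" "a \<in> arcs I" for b a
    using R that unfolding routing_def by blast
  have cover: "(\<Sum>b\<in>buses I. y'' b a) \<ge> 1" if a: "a \<in> A_d I" for a
  proof -
    have nonneg: "y'' b a \<ge> 0" if "b \<in> buses I" for b
      using y''01[OF that, of a] a unfolding arcs_def by auto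
    have IB_sum: "(\<Sum>b\<in>IB I. y'' b a) = (\<Sum>b\<in>IB I. y b a)"
      by (simp add: y''_def)
    have NB_sum: "(\<Sum>b\<in>NB I. y'' b a) = (\<Sum>b\<in>NB I. y' b a)"
      by (rule sum.cong) (use disj in \<open>auto simp: y''_def\<close>)
    show ?thesis
    proof (cases "h a = 1")
      case True
      then have "1 \<le> (\<Sum>b\<in>IB I. y'' b a)"
        using cov_IB a IB_sum by force
      also have "\<dots> \<le> (\<Sum>b\<in>buses I. y'' b a)"
        by (rule sum_mono2) (use finb IBb nonneg in auto)
      finally show ?thesis .
    next
      case False
      then have "1 \<le> (\<Sum>b\<in>NB I. y'' b a)"
        using cov_NB a NB_sum by simp
      also have "\<dots> \<le> (\<Sum>b\<in>buses I. y'' b a)"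
        by (rule sum_mono2) (use finb nonneg in \<open>auto simp: buses_def\<close>)
      finally show ?thesis .
    qed
  qed
  have x_sum: "(\<Sum>b\<in>buses I. x b) = real (max_IB I)"
    using cardIB finb IBb unfolding x_def by (simp add: sum.If_cases Int_absorb1)
  have x01: "\<forall>b\<in>buses I. x b \<in> {0, 1}"
    by (simp add: x_def)
  have lin: "\<forall>b\<in>buses I. \<forall>a\<in>arcs I.
      \<zeta> b a \<le> x b \<and> \<zeta> b a \<le> y'' b a \<and> \<zeta> b a \<ge> x b + y'' b a - 1 \<and> \<zeta> b a \<ge> 0"
    using y''01 by (fastforce simp: \<zeta>_def x_def)
  have "{b \<in> buses I. x b = 1} = IB I"
    using IBb by (auto simp: x_def)
  then have "coverage I (buses I) \<zeta> = coverage I (IB I) y''"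
    using coverage_linearized[OF finb x01 lin] by simp
  also have "\<dots> = q'"
    by (simp add: q'_def y''_def coverage_def fun_eq_iff)
  finally have "sensing I (buses I) \<zeta> q' r'"
    by (simp add: sensing_def r'_def fhat_le_piece)
  then have "(x, v'', y'', \<zeta>, q', r') \<in> P_feasible I"
    using R cover x_sum x01 lin unfolding P_feasible_def by simp
  then have "z_star I \<le> ereal (P_objective I (x, v'', y'', \<zeta>, q', r'))"
    unfolding z_star_def by (rule INF_lower)
  also have "\<dots> = evaluation I ((v, y, h, q, r), res)"
    by (simp add: evaluation_def total_cost_def res P_objective_def sensing_value_def
        y''_def[abs_def] r'_def[abs_def] q'_def)
  finally show ?thesis .
qed

lemma relative_gap_bound:
  fixes l s z u :: ereal
  assumes "0 < l" "l \<le> s" "s \<le> z" "z \<le> u" "s < \<infinity>"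
  shows "(z - s) / s \<le> u / l - 1"
proof -
  obtain s' where s: "s = ereal s'"
    using assms by (cases s) auto
  obtain l' where l: "l = ereal l'"
    using assms by (cases l) auto
  have pos: "0 < l'" "l' \<le> s'"
    using assms s l by auto
  show ?thesis
  proof (cases "u = \<infinity>")
    case True
    then show ?thesis
      using pos l by simp
  next
    case False
    then obtain u' where u: "u = ereal u'"
      using assms by (cases u) auto
    then obtain z' where z: "z = ereal z'"
      using assms s by (cases z) auto
    have le: "s' \<le> z'" "z' \<le> u'"
      using assms s z u by auto
    have "(z' - s') / s' = z' / s' - 1"
      using pos by (simp add: diff_divide_distrib)
    also have "\<dots> \<le> u' / l' - 1"
      using pos le by (simp add: frac_le)
    finally show ?thesis
      using pos by (simp add: s l u z one_ereal_def)
  qed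
qed

theorem proposition4p1:
  fixes I :: "('b, 'l, 'g, 'k) dbs_instance"
    and \<Delta> \<omega>max \<omega>out :: real
    and z C_BS R_BS C_DS :: ereal
  assumes "valid_instance I"
    and "\<Delta> > 0" and "\<omega>max > 0"
    and "batch_run I \<Delta> \<omega>max run"
    and "is_arg_min (\<lambda>\<omega>. evaluation I (run \<omega>)) (\<lambda>\<omega>. \<omega> \<in> tested \<Delta> \<omega>max) \<omega>out"
    and "z = evaluation I (run \<omega>out)"
    and "SP2_solution I v2 y2 h2 res2"
    and "run 0 = ((v2, y2, h2, q2, r2), res2)"
    and "C_BS = total_cost I y2 res2" and "R_BS = ereal (sensing_value I y2)"
    and "SP3_solution I v3 y3 q3 r3 res3"
    and "C_DS = total_cost I y3 res3"
  shows "(C_NB I - ereal (\<delta> I) * R_DS I \<le> z_star I \<and>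
          z_star I \<le> z \<and>
          z \<le> max (C_DS - ereal (\<delta> I) * R_DS I) (C_BS - ereal (\<delta> I) * R_BS))
       \<and> (P_feasible I \<noteq> {} \<longrightarrow> 0 < C_NB I - ereal (\<delta> I) * R_DS I \<longrightarrow>
          (z - z_star I) / z_star I
            \<le> max (C_DS - ereal (\<delta> I) * R_DS I) (C_BS - ereal (\<delta> I) * R_BS)
                / (C_NB I - ereal (\<delta> I) * R_DS I) - 1)"
proof -
  define lower where "lower = C_NB I - ereal (\<delta> I) * R_DS I"
  define upper where
    "upper = max (C_DS - ereal (\<delta> I) * R_DS I) (C_BS - ereal (\<delta> I) * R_BS)"
  have lower: "lower \<le> z_star I"
    unfolding lower_def using assms(1) by (rule lower_bound_le_z_star)
  obtain v y h q r res where out: "run \<omega>out = ((v, y, h, q, r), res)"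
    by (metis prod.exhaust)
  have "\<omega>out \<in> tested \<Delta> \<omega>max"
    using assms(5) unfolding is_arg_min_def by blast
  then have "case run \<omega>out of ((v, y, h, q, r), res) \<Rightarrow>
        is_arg_max (IB_objective I \<omega>out) (\<lambda>s. s \<in> IB_feasible I) (v, y, h, q, r) \<and>
        NB_result I (A_d I - {a \<in> A_d I. h a = 1}) res"
    using assms(4) unfolding batch_run_def by (rule bspec[rotated])
  then have "(v, y, h, q, r) \<in> IB_feasible I"
    and "NB_result I (A_d I - {a \<in> A_d I. h a = 1}) res"
    by (simp_all add: out is_arg_max_def)
  then have z: "z_star I \<le> z"
    unfolding assms(6) out by (rule z_star_le_evaluation[OF assms(1)])
  have "0 \<in> tested \<Delta> \<omega>max"
    using assms(3) unfolding tested_def by force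
  then have "z \<le> evaluation I (run 0)"
    using assms(5,6) unfolding is_arg_min_def by (meson not_less)
  also have "\<dots> = C_BS - ereal (\<delta> I) * R_BS"
    using assms(8-10) by (simp add: evaluation_def)
  finally have upper: "z \<le> upper"
    unfolding upper_def by (simp add: le_max_iff_disj)
  have "(z - z_star I) / z_star I \<le> upper / lower - 1"
    if feasible: "P_feasible I \<noteq> {}" and pos: "0 < lower"
  proof -
    obtain s where "s \<in> P_feasible I"
      using feasible by blast
    then have "z_star I \<le> ereal (P_objective I s)"
      unfolding z_star_def by (rule INF_lower)
    then have "z_star I < \<infinity>"
      by (metis ereal_infty_less(1) ereal_infty_less_eq(1) PInfty_neq_ereal(1))
    then show ?thesis
      using pos lower z upper by (intro relative_gap_bound)
  qed
  then show ?thesis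
    using lower z upper unfolding lower_def upper_def by blast
qed

end
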